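(* Let $X$ be a Tychonoff space with exactly one non-isolated point. Then $C_p(X)$ is a $k_{\mathbb{R}}$-space. If, in addition, the cardinal $|X|$ is not sequential, then $C_p(X)$ is an $s_{\mathbb{R}}$-space.
   Context: $C_p(X)$ is the space of continuous real-valued functions on $X$ with the topology of pointwise convergence. A function $f:Z\to\mathbb{R}$ is $k$-continuous if its restriction to every compact subset of $Z$ is continuous, and $s$-continuous (sequentially continuous) if its restriction to each convergent sequence in $Z$ (together with its limit) is continuous. $Z$ is a $k_{\mathbb{R}}$-space (resp. an $s_{\mathbb{R}}$-space) if every $k$-continuous (resp. $s$-continuous) function $f:Z\to\mathbb{R}$ is continuous. A cardinal $\tau$ is sequential if there exists a sequentially continuous function $f:\{0,1\}^\tau\to\mathbb{R}$ which is discontinuous, where $\{0,1\}$ is discrete and $\{0,1\}^\tau$ has the product topology. *)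

theory Defs
  imports "HOL-Analysis.Analysis"
begin

definition tychonoff_space :: "'a topology \<Rightarrow> bool"
  where "tychonoff_space X \<longleftrightarrow> completely_regular_space X \<and> Hausdorff_space X"

text \<open>Points of \<^term>\<open>powertop_real (topspace X)\<close> are extensional on \<^term>\<open>topspace X\<close>,
  so each continuous real-valued function on \<^term>\<open>X\<close> is represented exactly once.\<close>

definition Cp :: "'a topology \<Rightarrow> ('a \<Rightarrow> real) topology"
  where "Cp X = subtopology (powertop_real (topspace X)) {f. continuous_map X euclideanreal f}"

definition k_continuous :: "'a topology \<Rightarrow> ('a \<Rightarrow> real) \<Rightarrow> bool"
  where "k_continuous Z f \<longleftrightarrow>
    (\<forall>K. compactin Z K \<longrightarrow> continuous_map (subtopology Z K) euclideanreal f)"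

text \<open>\<^const>\<open>limitin\<close> only constrains a tail of the sequence, hence the explicit condition that
  all its terms are points of the space.\<close>

definition s_continuous :: "'a topology \<Rightarrow> ('a \<Rightarrow> real) \<Rightarrow> bool"
  where "s_continuous Z f \<longleftrightarrow>
    (\<forall>(\<sigma>::nat \<Rightarrow> 'a) l. range \<sigma> \<subseteq> topspace Z \<and> limitin Z \<sigma> l sequentially \<longrightarrow>
      continuous_map (subtopology Z (insert l (range \<sigma>))) euclideanreal f)"

definition k_real_space :: "'a topology \<Rightarrow> bool"
  where "k_real_space Z \<longleftrightarrow>
    (\<forall>f. k_continuous Z f \<longrightarrow> continuous_map Z euclideanreal f)"

definition s_real_space :: "'a topology \<Rightarrow> bool"
  where "s_real_space Z \<longleftrightarrow>
    (\<forall>f. s_continuous Z f \<longrightarrow> continuous_map Z euclideanreal f)"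

text \<open>Cardinals are represented as in the library, by minimal well-orders on their fields; the
  field of \<open>\<tau>\<close> is then an index set of cardinality \<open>\<tau>\<close>. In particular
  \<^term>\<open>Field (card_of A) = A\<close>.\<close>

definition cantor_cube :: "'a rel \<Rightarrow> ('a \<Rightarrow> nat) topology"
  where "cantor_cube \<tau> = product_topology (\<lambda>_. discrete_topology {0, 1}) (Field \<tau>)"

definition sequential_cardinal :: "'a rel \<Rightarrow> bool"
  where "sequential_cardinal \<tau> \<longleftrightarrow> Card_order \<tau> \<and>
    (\<exists>f. s_continuous (cantor_cube \<tau>) f \<and> \<not> continuous_map (cantor_cube \<tau>) euclideanreal f)"

end

(* Let p be the non-isolated point and suppose F is discontinuous at f0. Every neighbourhood of f0
   contains some f with |F f - F f0| bounded below. The functions agreeing with f on a set of points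
   and with the translate f0 + (f p - f0 p) elsewhere are all continuous, and they form a continuous
   image of a Cantor cube; if F is continuous along this cube, then f may be replaced by a function
   that is a translate of f0 off a finite set. Choosing such functions successively, each close to f0
   where the previous ones are not translates of it, gives a sequence converging pointwise to f0
   along which F does not converge to F f0. *)
theory Submission
  imports Defs
begin

lemma continuous_map_euclideanreal_iff:
  "continuous_map X euclideanreal g \<longleftrightarrow>
    (\<forall>x\<in>topspace X. \<forall>\<epsilon>>0. \<exists>U. openin X U \<and> x \<in> U \<and> (\<forall>y\<in>U. \<bar>g y - g x\<bar> < \<epsilon>))"
  using Met_TC.continuous_map_to_metric[of X g]
  by (simp add: dist_real_def abs_minus_commute)

text \<open>Only \<open>p\<close> needs an argument, since any other point has itself as a
  neighbourhood. At \<open>p\<close> both branches take the same value, so on the intersection of a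
  neighbourhood for \<open>f\<close> and one for \<open>g\<close> the estimate holds whichever
  branch \<open>P\<close> selects. Hence \<open>P\<close> can be arbitrary.\<close>

lemma continuous_map_if_isolated:
  assumes iso: "\<And>x. x \<in> topspace X \<Longrightarrow> x \<noteq> p \<Longrightarrow> openin X {x}"
    and f: "continuous_map X euclideanreal f" and g: "continuous_map X euclideanreal g"
    and "f p = g p"
  shows "continuous_map X euclideanreal (\<lambda>x. if P x then f x else g x)"
  unfolding continuous_map_euclideanreal_iff
proof (intro ballI allI impI)
  fix x :: 'a and \<epsilon> :: real assume x: "x \<in> topspace X" and "\<epsilon> > 0"
  let ?h = "\<lambda>x. if P x then f x else g x"
  show "\<exists>U. openin X U \<and> x \<in> U \<and> (\<forall>y\<in>U. \<bar>?h y - ?h x\<bar> < \<epsilon>)"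
  proof (cases "x = p")
    case False
    then show ?thesis using iso[OF x] \<open>\<epsilon> > 0\<close> by (intro exI[of _ "{x}"]) auto
  next
    case True
    obtain U where U: "openin X U" "x \<in> U" "\<And>y. y \<in> U \<Longrightarrow> \<bar>f y - f x\<bar> < \<epsilon>"
      using f x \<open>\<epsilon> > 0\<close> unfolding continuous_map_euclideanreal_iff by metis
    obtain V where V: "openin X V" "x \<in> V" "\<And>y. y \<in> V \<Longrightarrow> \<bar>g y - g x\<bar> < \<epsilon>"
      using g x \<open>\<epsilon> > 0\<close> unfolding continuous_map_euclideanreal_iff by metis
    have "\<bar>?h y - ?h x\<bar> < \<epsilon>" if "y \<in> U \<inter> V" for y
      using that U(3)[of y] V(3)[of y] True \<open>f p = g p\<close> by simp
    then show ?thesis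
      using U(1,2) V(1,2) by (meson IntI openin_Int)
  qed
qed

lemma topspace_Cp:
  "topspace (Cp X) = {f \<in> extensional (topspace X). continuous_map X euclideanreal f}"
  by (auto simp: Cp_def PiE_def)

lemma continuous_map_Cp_eval: "x \<in> topspace X \<Longrightarrow> continuous_map (Cp X) euclideanreal (\<lambda>f. f x)"
  unfolding Cp_def
  by (intro continuous_map_from_subtopology continuous_map_product_projection)

lemma limitin_Cp:
  assumes "range \<sigma> \<subseteq> topspace (Cp X)" "l \<in> topspace (Cp X)"
    and "\<And>x. x \<in> topspace X \<Longrightarrow> (\<lambda>n. \<sigma> n x) \<longlonglongrightarrow> l x"
  shows "limitin (Cp X) \<sigma> l sequentially"
proof -
  have "\<sigma> n \<in> extensional (topspace X)" "continuous_map X euclideanreal (\<sigma> n)" for n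
    using assms(1) by (auto simp: topspace_Cp)
  then show ?thesis
    using assms(2,3) unfolding Cp_def
    by (auto simp: limitin_subtopology limitin_componentwise PiE_def)
qed

lemma openin_Cp_basic:
  assumes "finite T" "T \<subseteq> topspace X"
  shows "openin (Cp X) {f \<in> topspace (Cp X). \<forall>x\<in>T. \<bar>f x - g x\<bar> < \<delta>}"
  using assms
proof (induction T)
  case empty
  then show ?case by simp
next
  case (insert x T)
  have "openin (Cp X) {f \<in> topspace (Cp X). f x \<in> ball (g x) \<delta>}"
    using insert.prems by (intro openin_continuous_map_preimage[OF continuous_map_Cp_eval]) auto
  then have "openin (Cp X) ({f \<in> topspace (Cp X). \<forall>x\<in>T. \<bar>f x - g x\<bar> < \<delta>} \<inter>
      {f \<in> topspace (Cp X). f x \<in> ball (g x) \<delta>})"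
    using insert by (intro openin_Int) auto
  then show ?case
    by (rule back_subst[of "openin (Cp X)"]) (auto simp: dist_real_def abs_minus_commute)
qed

lemma compact_space_cantor_cube: "compact_space (cantor_cube \<tau>)"
  unfolding cantor_cube_def by (auto simp: compact_space_product_topology compact_space_discrete_topology)

lemma topspace_cantor_cube: "topspace (cantor_cube \<tau>) = Field \<tau> \<rightarrow>\<^sub>E {0, 1}"
  by (simp add: cantor_cube_def)

text \<open>Each coordinate of the image depends on the single coordinate \<open>e x\<close>, which
  ranges over a discrete space. The spliced function lies in \<open>Cp X\<close> for every
  \<open>e\<close> because \<open>f\<close> and \<open>g\<close> agree at \<open>p\<close>.\<close>

lemma continuous_map_cantor_cube_truncation:
  assumes iso: "\<And>x. x \<in> topspace X \<Longrightarrow> x \<noteq> p \<Longrightarrow> openin X {x}"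
    and "f \<in> topspace (Cp X)" "g \<in> topspace (Cp X)" "f p = g p"
  shows "continuous_map (cantor_cube (card_of (topspace X))) (Cp X)
    (\<lambda>e. \<lambda>x\<in>topspace X. if e x = 1 then f x else g x)"
proof -
  let ?C = "cantor_cube (card_of (topspace X))"
  have "continuous_map ?C euclideanreal (\<lambda>e. if e x = 1 then f x else g x)"
    if "x \<in> topspace X" for x
  proof -
    have "continuous_map ?C (discrete_topology {0, 1}) (\<lambda>e. e x)"
      unfolding cantor_cube_def using that
      by (intro continuous_map_product_projection) (simp add: Field_card_of)
    moreover have "continuous_map (discrete_topology {0, 1::nat}) euclideanreal
        (\<lambda>i. if i = 1 then f x else g x)"
      by simp
    ultimately show ?thesis
      by (rule continuous_map_compose[unfolded o_def])
  qed
  moreover have "continuous_map X euclideanreal (\<lambda>x\<in>topspace X. if e x = 1 then f x else g x)"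
    for e :: "'a \<Rightarrow> nat"
  proof -
    have "continuous_map X euclideanreal (\<lambda>x. if e x = 1 then f x else g x)"
      using continuous_map_if_isolated[where f = f and g = g and P = "\<lambda>x. e x = 1", OF iso]
        assms(2-4)
      by (simp add: topspace_Cp)
    then show ?thesis by (rule continuous_map_eq) simp
  qed
  ultimately show ?thesis
    unfolding Cp_def continuous_map_in_subtopology continuous_map_componentwise
    by (simp add: image_subset_iff)
qed

lemma s_continuous_limit:
  assumes "s_continuous Z F" "range \<sigma> \<subseteq> topspace Z" "limitin Z \<sigma> l sequentially"
  shows "(\<lambda>n. F (\<sigma> n)) \<longlonglongrightarrow> F l"
proof -
  let ?S = "insert l (range \<sigma>)"
  have "continuous_map (subtopology Z ?S) euclideanreal F"
    using assms by (auto simp: s_continuous_def)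
  moreover have "limitin (subtopology Z ?S) \<sigma> l sequentially"
    using assms by (auto simp: limitin_subtopology)
  ultimately show ?thesis
    using continuous_map_limit[of _ euclideanreal F \<sigma> l sequentially] by (simp add: o_def)
qed

text \<open>A convergent sequence together with its limit is compact.\<close>

lemma k_continuous_imp_s_continuous: "k_continuous Z F \<Longrightarrow> s_continuous Z F"
  unfolding k_continuous_def s_continuous_def
  by (metis compactin_sequence_with_limit order_refl)

text \<open>Continuous maps send convergent sequences to convergent sequences. With \<open>Y\<close>
  a Cantor cube, this turns an s-continuous function on \<open>Cp X\<close> into one on the cube,
  where non-sequentiality of the cardinal applies.\<close>

lemma s_continuous_compose:
  assumes "s_continuous Z F" and \<phi>: "continuous_map Y Z \<phi>"
  shows "s_continuous Y (F \<circ> \<phi>)"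
  unfolding s_continuous_def
proof (intro allI impI, elim conjE)
  fix \<sigma> :: "nat \<Rightarrow> _" and l
  assume \<sigma>: "range \<sigma> \<subseteq> topspace Y" and l: "limitin Y \<sigma> l sequentially"
  let ?S = "insert (\<phi> l) (range (\<phi> \<circ> \<sigma>))"
  have "limitin Z (\<phi> \<circ> \<sigma>) (\<phi> l) sequentially"
    using continuous_map_limit[OF \<phi> l] .
  moreover have "range (\<phi> \<circ> \<sigma>) \<subseteq> topspace Z"
    using \<sigma> \<phi> by (auto simp: continuous_map_def)
  ultimately have "continuous_map (subtopology Z ?S) euclideanreal F"
    using assms(1)[unfolded s_continuous_def, rule_format, of "\<phi> \<circ> \<sigma>" "\<phi> l"] by simp
  moreover have "continuous_map (subtopology Y (insert l (range \<sigma>))) (subtopology Z ?S) \<phi>"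
    using \<phi> by (auto simp: continuous_map_in_subtopology continuous_map_from_subtopology)
  ultimately show "continuous_map (subtopology Y (insert l (range \<sigma>))) euclideanreal (F \<circ> \<phi>)"
    by (rule continuous_map_compose[rotated])
qed

text \<open>The image of \<open>Y\<close> is one compact set, and k-continuity on that set
  suffices.\<close>

lemma k_continuous_compose_compact:
  assumes "k_continuous Z F" "compact_space Y" and \<phi>: "continuous_map Y Z \<phi>"
  shows "continuous_map Y euclideanreal (F \<circ> \<phi>)"
proof -
  have "compactin Z (\<phi> ` topspace Y)"
    using image_compactin[OF _ \<phi>] assms(2) by (simp add: compact_space_def)
  then have "continuous_map (subtopology Z (\<phi> ` topspace Y)) euclideanreal F"
    using assms(1) by (auto simp: k_continuous_def)
  moreover have "continuous_map Y (subtopology Z (\<phi> ` topspace Y)) \<phi>"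
    using \<phi> by (auto simp: continuous_map_in_subtopology)
  ultimately show ?thesis
    by (rule continuous_map_compose[rotated])
qed

text \<open>A basic neighbourhood of a point of the cube restricts only finitely many coordinates.
  Switching all the others from \<open>f\<close> to the translate of \<open>f0\<close> therefore
  changes \<open>F\<close> by less than \<open>\<eta>\<close>.\<close>

lemma Cp_truncate:
  assumes iso: "\<And>x. x \<in> topspace X \<Longrightarrow> x \<noteq> p \<Longrightarrow> openin X {x}"
    and p: "p \<in> topspace X"
    and cube: "\<And>\<phi>. continuous_map (cantor_cube (card_of (topspace X))) (Cp X) \<phi> \<Longrightarrow>
      continuous_map (cantor_cube (card_of (topspace X))) euclideanreal (F \<circ> \<phi>)"
    and f: "f \<in> topspace (Cp X)" and f0: "f0 \<in> topspace (Cp X)"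
    and T: "finite T" "T \<subseteq> topspace X" and "\<eta> > 0"
  obtains S g where "finite S" "T \<subseteq> S" "S \<subseteq> topspace X" "g \<in> topspace (Cp X)"
    "\<And>x. x \<in> S \<Longrightarrow> g x = f x"
    "\<And>x. x \<in> topspace X - S \<Longrightarrow> g x = f0 x + (f p - f0 p)"
    "\<bar>F g - F f\<bar> < \<eta>"
proof -
  let ?C = "cantor_cube (card_of (topspace X))"
  \<comment> \<open>The shift makes \<open>f1 p = f p\<close>, which is what splicing
    \<open>f\<close> with \<open>f1\<close> requires.\<close>
  define f1 where "f1 = (\<lambda>x\<in>topspace X. f0 x + (f p - f0 p))"
  define \<phi> where "\<phi> = (\<lambda>e::'a \<Rightarrow> nat. \<lambda>x\<in>topspace X. if e x = 1 then f x else f1 x)"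
  have "continuous_map X euclideanreal (\<lambda>x. f0 x + (f p - f0 p))"
    using f0 by (intro continuous_map_add) (auto simp: topspace_Cp)
  then have "continuous_map X euclideanreal f1"
    by (rule continuous_map_eq) (simp add: f1_def)
  then have f1: "f1 \<in> topspace (Cp X)" "f p = f1 p"
    using p by (auto simp: topspace_Cp f1_def)
  have \<phi>: "continuous_map ?C (Cp X) \<phi>"
    unfolding \<phi>_def using continuous_map_cantor_cube_truncation[OF iso f f1] .
  define one where "one = (\<lambda>x\<in>topspace X. 1::nat)"
  have one: "one \<in> topspace ?C"
    by (auto simp: topspace_cantor_cube one_def Field_card_of)
  have "\<phi> one = f"
    using f by (auto simp: \<phi>_def one_def topspace_Cp extensional_def fun_eq_iff)
  then obtain U where U: "openin ?C U" "one \<in> U" "\<And>e. e \<in> U \<Longrightarrow> \<bar>F (\<phi> e) - F f\<bar> < \<eta>"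
    using cube[OF \<phi>] one \<open>\<eta> > 0\<close> unfolding continuous_map_euclideanreal_iff o_def by metis
  obtain V where V: "finite {x \<in> topspace X. V x \<noteq> {0, 1}}" "one \<in> Pi\<^sub>E (topspace X) V"
      "Pi\<^sub>E (topspace X) V \<subseteq> U"
    using U(1,2) unfolding cantor_cube_def openin_product_topology_alt
    by (auto simp: Field_card_of)
  define S where "S = insert p (T \<union> {x \<in> topspace X. V x \<noteq> {0, 1}})"
  define e where "e = (\<lambda>x\<in>topspace X. if x \<in> S then 1 else 0::nat)"
  \<comment> \<open>On \<open>S\<close> the point \<open>e\<close> agrees with \<open>one\<close>,
    which lies in the box; off \<open>S\<close> the factor \<open>V x\<close> is all of
    \<open>{0, 1}\<close>.\<close>
  have "e \<in> Pi\<^sub>E (topspace X) V"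
    using V(2) by (fastforce simp: e_def one_def S_def PiE_iff)
  with U(3) V(3) have "\<bar>F (\<phi> e) - F f\<bar> < \<eta>" "e \<in> topspace ?C"
    using openin_subset[OF U(1)] by blast+
  show thesis
  proof (rule that[of S "\<phi> e"])
    show "\<phi> e \<in> topspace (Cp X)"
      using \<phi> \<open>e \<in> topspace ?C\<close> by (auto simp: continuous_map_def)
    show S: "S \<subseteq> topspace X" using p T by (auto simp: S_def)
    show "\<phi> e x = f x" if "x \<in> S" for x
      using that S by (auto simp: \<phi>_def e_def)
    show "\<phi> e x = f0 x + (f p - f0 p)" if "x \<in> topspace X - S" for x
      using that by (auto simp: \<phi>_def e_def f1_def)
  qed (use V T \<open>\<bar>F (\<phi> e) - F f\<bar> < \<eta>\<close> in \<open>auto simp: S_def\<close>)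
qed

text \<open>This is the common core of both claims of the theorem, which differ only in how
  \<open>cube\<close> is obtained: from compactness of the cube for k-continuous \<open>F\<close>,
  from the cardinal not being sequential for s-continuous \<open>F\<close>.\<close>

lemma continuous_map_Cp_if_cube_continuous:
  assumes iso: "\<And>x. x \<in> topspace X \<Longrightarrow> x \<noteq> p \<Longrightarrow> openin X {x}"
    and p: "p \<in> topspace X"
    and cube: "\<And>\<phi>. continuous_map (cantor_cube (card_of (topspace X))) (Cp X) \<phi> \<Longrightarrow>
      continuous_map (cantor_cube (card_of (topspace X))) euclideanreal (F \<circ> \<phi>)"
    and s: "s_continuous (Cp X) F"
  shows "continuous_map (Cp X) euclideanreal F"
proof (rule ccontr)
  assume "\<not> ?thesis"
  then obtain f0 \<epsilon> where f0: "f0 \<in> topspace (Cp X)" and "\<epsilon> > 0"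
    and far: "\<And>U. openin (Cp X) U \<Longrightarrow> f0 \<in> U \<Longrightarrow> \<exists>f\<in>U. \<bar>F f - F f0\<bar> \<ge> \<epsilon>"
    unfolding continuous_map_euclideanreal_iff by (metis not_less)
  \<comment> \<open>Keeping \<open>p\<close> in every stage makes closeness to \<open>f0\<close> on
    \<open>T\<close> also bound the translation constant \<open>g p - f0 p\<close>.\<close>
  define ok where "ok T \<longleftrightarrow> finite T \<and> p \<in> T \<and> T \<subseteq> topspace X" for T
  \<comment> \<open>\<open>T\<close> is the old stage and \<open>S\<close> the new one; on
    \<open>S - T\<close> the values of \<open>g\<close> are unconstrained. The bound is
    \<open>\<epsilon> / 2\<close> because truncation may cost the other half of
    \<open>\<epsilon>\<close>.\<close>
  define good where "good T \<delta> S g \<longleftrightarrow> T \<subseteq> S \<and> g \<in> topspace (Cp X) \<and> (\<forall>x\<in>T. \<bar>g x - f0 x\<bar> < \<delta>) \<and>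
      (\<forall>x\<in>topspace X - S. g x - f0 x = g p - f0 p) \<and> \<bar>F g - F f0\<bar> \<ge> \<epsilon> / 2" for T \<delta> S g
  have step: "\<exists>S. ok S \<and> (\<exists>g. good T \<delta> S g)" if "ok T" "\<delta> > 0" for T \<delta>
  proof -
    have T: "finite T" "p \<in> T" "T \<subseteq> topspace X" using that by (auto simp: ok_def)
    obtain f where f: "f \<in> topspace (Cp X)" "\<And>x. x \<in> T \<Longrightarrow> \<bar>f x - f0 x\<bar> < \<delta>" "\<bar>F f - F f0\<bar> \<ge> \<epsilon>"
      using far[OF openin_Cp_basic[OF T(1,3), of f0 \<delta>]] f0 \<open>\<delta> > 0\<close> by auto
    have "\<epsilon> / 2 > 0" using \<open>\<epsilon> > 0\<close> by simp
    obtain S g where S: "finite S" "T \<subseteq> S" "S \<subseteq> topspace X" and g: "g \<in> topspace (Cp X)"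
      "\<And>x. x \<in> S \<Longrightarrow> g x = f x"
      "\<And>x. x \<in> topspace X - S \<Longrightarrow> g x = f0 x + (f p - f0 p)" "\<bar>F g - F f\<bar> < \<epsilon> / 2"
      using Cp_truncate[OF iso p cube f(1) f0 T(1,3) \<open>\<epsilon> / 2 > 0\<close>] by metis
    have "g p = f p" using g S T by auto
    moreover have "\<bar>F g - F f0\<bar> \<ge> \<epsilon> / 2" using g(4) f(3) by linarith
    moreover have "\<bar>g x - f0 x\<bar> < \<delta>" if "x \<in> T" for x
      using that f(2) g(2) S(2) by (metis subsetD)
    ultimately have "ok S \<and> good T \<delta> S g"
      using S g T by (auto simp: ok_def good_def)
    then show ?thesis by blast
  qed
  \<comment> \<open>Only the stages are chosen recursively. The set off which one function is a
    translate is the set on which the next one must be close to \<open>f0\<close>.\<close>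
  have "\<exists>T. \<forall>n. ok (T n) \<and> (\<exists>g. good (T n) (inverse (real (Suc n))) (T (Suc n)) g)"
  proof (rule dependent_nat_choice)
    show "\<exists>T. ok T" using p by (intro exI[of _ "{p}"]) (simp add: ok_def)
  qed (use step in auto)
  then obtain T g where T: "\<And>n. ok (T n)"
    and g: "\<And>n. good (T n) (inverse (real (Suc n))) (T (Suc n)) (g n)"
    by metis
  have "incseq T" using g by (intro incseq_SucI) (auto simp: good_def)
  have "limitin (Cp X) g f0 sequentially"
  proof (rule limitin_Cp)
    fix x assume x: "x \<in> topspace X"
    \<comment> \<open>A point in some stage lies in all later ones, where closeness is explicit. A
      point in no stage always sees a translate, so its deviation equals the one at
      \<open>p\<close>, which belongs to every stage.\<close>
    have "\<exists>N. \<forall>n\<ge>N. \<bar>g n x - f0 x\<bar> \<le> inverse (real (Suc n))"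
    proof (cases "\<exists>N. x \<in> T N")
      case True
      then obtain N where "x \<in> T N" ..
      then have "x \<in> T n" if "n \<ge> N" for n
        using \<open>incseq T\<close> that by (auto simp: incseq_def)
      then show ?thesis using g unfolding good_def by (meson less_imp_le)
    next
      case False
      then have "g n x - f0 x = g n p - f0 p" for n
        using g x by (auto simp: good_def)
      moreover have "\<bar>g n p - f0 p\<bar> < inverse (real (Suc n))" for n
        using g T unfolding good_def ok_def by blast
      ultimately show ?thesis using less_imp_le by metis
    qed
    then have "\<forall>\<^sub>F n in sequentially. norm (g n x - f0 x) \<le> inverse (real (Suc n))"
      by (simp add: eventually_sequentially)
    then have "(\<lambda>n. g n x - f0 x) \<longlonglongrightarrow> 0"
      using LIMSEQ_inverse_real_of_nat by (rule Lim_null_comparison)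
    then show "(\<lambda>n. g n x) \<longlonglongrightarrow> f0 x" by (rule LIM_zero_cancel)
  qed (use g f0 in \<open>auto simp: good_def\<close>)
  then have "(\<lambda>n. F (g n)) \<longlonglongrightarrow> F f0"
    using g by (intro s_continuous_limit[OF s]) (auto simp: good_def)
  then obtain n where "\<bar>F (g n) - F f0\<bar> < \<epsilon> / 2"
    using \<open>\<epsilon> > 0\<close> unfolding LIMSEQ_def dist_real_def by (meson half_gt_zero order_refl)
  moreover have "\<bar>F (g n) - F f0\<bar> \<ge> \<epsilon> / 2" using g by (auto simp: good_def)
  ultimately show False by linarith
qed

theorem theorem11p6:
  fixes X :: "'a topology"
  assumes "tychonoff_space X"
    and "\<exists>!x. x \<in> topspace X \<and> \<not> openin X {x}"
  shows "k_real_space (Cp X) \<and>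
    (\<not> sequential_cardinal (card_of (topspace X)) \<longrightarrow> s_real_space (Cp X))"
proof -
  obtain p where p: "p \<in> topspace X"
    and iso: "\<And>x. x \<in> topspace X \<Longrightarrow> x \<noteq> p \<Longrightarrow> openin X {x}"
    using assms(2) by blast
  note cont = continuous_map_Cp_if_cube_continuous[OF iso p]
  show ?thesis
  proof (intro conjI impI)
    show "k_real_space (Cp X)"
      unfolding k_real_space_def
      by (blast intro: cont k_continuous_compose_compact compact_space_cantor_cube
          k_continuous_imp_s_continuous)
  next
    assume "\<not> sequential_cardinal (card_of (topspace X))"
    \<comment> \<open>As \<open>card_of\<close> always yields a cardinal order, the negated
      definition leaves exactly that no s-continuous function on this cube is discontinuous.\<close>
    then have "continuous_map (cantor_cube (card_of (topspace X))) euclideanreal G"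
      if "s_continuous (cantor_cube (card_of (topspace X))) G" for G
      using that card_of_Card_order by (auto simp: sequential_cardinal_def)
    then show "s_real_space (Cp X)"
      unfolding s_real_space_def by (blast intro: cont s_continuous_compose)
  qed
qed

end
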